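(* Let $\mathbb{J}$ be a transferable class of filters, and let $J$ be a $\mathbb{J}$-adherence-determined reflector. Let $\xi$ and $\tau$ be convergences and let $f:|\xi|\to|\tau|$ be a surjective map. Then the following statements are equivalent: (1) $f\in C(J\xi,J\tau)$, that is, $f$ is continuous from $J\xi$ to $J\tau$; (2) for each filter $\mathcal{H}\in\mathbb{J}$ on $|\tau|$, $\operatorname{adh}_{\xi}f^{-}[\mathcal{H}]\subset f^{-}(\operatorname{adh}_{\tau}\mathcal{H})$; (3) for each filter $\mathcal{G}\in\mathbb{J}$ on $|\xi|$, $f(\operatorname{adh}_{\xi}\mathcal{G})\subset\operatorname{adh}_{\tau}f[\mathcal{G}]$.
   Context: Filters are non-degenerate. A convergence $\xi$ on a set $X=|\xi|$ is a relation $x\in\lim_{\xi}\mathcal{F}$ between filters $\mathcal{F}$ on $X$ and points $x\in X$ such that $\mathcal{F}_0\subset\mathcal{F}_1$ implies $\lim_{\xi}\mathcal{F}_0\subset\lim_{\xi}\mathcal{F}_1$, and $x\in\lim_{\xi}\{x\}^{\uparrow}$ for each $x$, where $\{A\}^\uparrow=\{F\subset X:A\subset F\}$ is the principal filter of $A$ and $\{x\}^{\uparrow}$ is the principal ultrafilter of $x$. For maps, $f[\mathcal{A}]=\{f(A):A\in\mathcal{A}\}$, $f^{-}(B)$ is the preimage of $B$, and $f^{-}[\mathcal{B}]=\{f^{-}(B):B\in\mathcal{B}\}$; filter bases are identified with the filters they generate. A map $f$ is continuous from $\xi$ to $\tau$, written $f\in C(\xi,\tau)$, if $f(\lim_{\xi}\mathcal{F})\subset\lim_{\tau}f[\mathcal{F}]$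 for each filter $\mathcal{F}$ on $|\xi|$. Families mesh, $\mathcal{A}\#\mathcal{H}$, if $A\cap H\neq\varnothing$ for all $A\in\mathcal{A},H\in\mathcal{H}$. The adherence is $\operatorname{adh}_{\xi}\mathcal{A}=\bigcup\{\lim_{\xi}\mathcal{H}:\mathcal{H}\text{ a filter},\ \mathcal{H}\#\mathcal{A}\}$. A class $\mathbb{J}$ of filters is transferable if $\mathcal{J}\in\mathbb{J}$ implies $R[\mathcal{J}]\in\mathbb{J}$ for each relation $R$, where $R[\mathcal{J}]=\{RA:A\in\mathcal{J}\}$ and $RA=\bigcup_{w\in A}\{z:(w,z)\in R\}$. A class is initial if $\mathcal{H}\in\mathbb{J}$ implies $f^{-}[\mathcal{H}]\in\mathbb{J}$ for maps $f$ (every transferable class is initial). An operator $J$, assigning to each convergence $\theta$ a convergence $J\theta$ on $|\theta|$, is $\mathbb{J}$-adherence-determined if $\mathbb{J}$ is an initial class of filters containing all principal filters and, for each $\theta$ and each filter $\mathcal{F}$ on $|\theta|$, $\lim_{J\theta}\mathcal{F}=\bigcap\{\operatorname{adh}_{\theta}\mathcal{H}:\mathcal{H}\in\mathbb{J},\ \mathcal{H}\#\mathcal{F}\}$. Such an operator is automatically a concrete reflector. *)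

theory Defs
  imports Complex_Main
begin

text \<open>
  All underlying sets are subsets of one arbitrary universe type, so that a class of filters may
  contain filters on different sets. A filter on \<open>X\<close> is represented by the library filter
  on the universe that it generates. The order of library filters is reverse inclusion, and the
  library filter \<open>bot\<close> is the degenerate one.
\<close>

definition filters_on :: "'u set \<Rightarrow> 'u filter set" where
  "filters_on X = {F. F \<noteq> bot \<and> (\<forall>\<^sub>F x in F. x \<in> X)}"

definition sets_of :: "'u filter \<Rightarrow> 'u set set" where
  "sets_of F = {A. \<forall>\<^sub>F x in F. x \<in> A}"

definition mesh :: "'u filter \<Rightarrow> 'u filter \<Rightarrow> bool" where
  "mesh F H \<longleftrightarrow> (\<forall>A\<in>sets_of F. \<forall>B\<in>sets_of H. A \<inter> B \<noteq> {})"

record 'u conv =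
  points :: "'u set"
  limit :: "'u filter \<Rightarrow> 'u set"

text \<open>
  The values of \<open>limit\<close> at arguments that are not filters on the underlying set are fixed to be
  empty, so that a convergence is determined by its relation between filters and points.
\<close>

definition convergence :: "'u conv \<Rightarrow> bool" where
  "convergence \<xi> \<longleftrightarrow>
     (\<forall>F. limit \<xi> F \<subseteq> points \<xi>) \<and>
     (\<forall>F. F \<notin> filters_on (points \<xi>) \<longrightarrow> limit \<xi> F = {}) \<and>
     (\<forall>F\<^sub>0\<in>filters_on (points \<xi>). \<forall>F\<^sub>1\<in>filters_on (points \<xi>).
        sets_of F\<^sub>0 \<subseteq> sets_of F\<^sub>1 \<longrightarrow> limit \<xi> F\<^sub>0 \<subseteq> limit \<xi> F\<^sub>1) \<and>
     (\<forall>x\<in>points \<xi>. x \<in> limit \<xi> (principal {x}))"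

definition continuous_conv :: "'u conv \<Rightarrow> 'u conv \<Rightarrow> ('u \<Rightarrow> 'u) \<Rightarrow> bool" where
  "continuous_conv \<xi> \<tau> f \<longleftrightarrow>
     f ` points \<xi> \<subseteq> points \<tau> \<and>
     (\<forall>F\<in>filters_on (points \<xi>). f ` limit \<xi> F \<subseteq> limit \<tau> (filtermap f F))"

definition adh :: "'u conv \<Rightarrow> 'u filter \<Rightarrow> 'u set" where
  "adh \<xi> A = \<Union>{limit \<xi> H | H. H \<in> filters_on (points \<xi>) \<and> mesh H A}"

text \<open>The preimage filter of a map with domain \<open>X\<close>: it is generated by the sets
  \<open>{x \<in> X. f x \<in> B}\<close> for \<open>B\<close> in \<open>H\<close>.\<close>

definition preimage_filter :: "'u set \<Rightarrow> ('u \<Rightarrow> 'u) \<Rightarrow> 'u filter \<Rightarrow> 'u filter" where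
  "preimage_filter X f H = inf (principal X) (filtercomap f H)"

definition relation_filter :: "('u \<times> 'u) set \<Rightarrow> 'u filter \<Rightarrow> 'u filter" where
  "relation_filter R F = (INF A\<in>sets_of F. principal (R `` A))"

text \<open>
  A class of filters is given by the set of its members on each underlying set.
  Since filters are non-degenerate, the closure conditions below concern those images and
  preimages that are filters, i.e. that differ from \<open>bot\<close>.
\<close>

definition filter_class :: "('u set \<Rightarrow> 'u filter set) \<Rightarrow> bool" where
  "filter_class \<J> \<longleftrightarrow> (\<forall>X. \<J> X \<subseteq> filters_on X)"

definition transferable :: "('u set \<Rightarrow> 'u filter set) \<Rightarrow> bool" where
  "transferable \<J> \<longleftrightarrow>
     (\<forall>X Y R. R \<subseteq> X \<times> Y \<longrightarrow>
        (\<forall>F\<in>\<J> X. relation_filter R F \<noteq> bot \<longrightarrow> relation_filter R F \<in> \<J> Y))"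

definition initial :: "('u set \<Rightarrow> 'u filter set) \<Rightarrow> bool" where
  "initial \<J> \<longleftrightarrow>
     (\<forall>X Y f. f ` X \<subseteq> Y \<longrightarrow>
        (\<forall>H\<in>\<J> Y. preimage_filter X f H \<noteq> bot \<longrightarrow> preimage_filter X f H \<in> \<J> X))"

definition adherence_determined ::
    "('u set \<Rightarrow> 'u filter set) \<Rightarrow> ('u conv \<Rightarrow> 'u conv) \<Rightarrow> bool" where
  "adherence_determined \<J> J \<longleftrightarrow>
     initial \<J> \<and>
     (\<forall>X A. A \<subseteq> X \<and> A \<noteq> {} \<longrightarrow> principal A \<in> \<J> X) \<and>
     (\<forall>\<theta>. convergence \<theta> \<longrightarrow>
        convergence (J \<theta>) \<and> points (J \<theta>) = points \<theta> \<and>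
        (\<forall>F\<in>filters_on (points \<theta>).
           limit (J \<theta>) F = \<Inter>{adh \<theta> H | H. H \<in> \<J> (points \<theta>) \<and> mesh H F}))"

end

(* Everything rests on two observations. A filter F on |xi| meshes with the preimage of H iff the
   image of F meshes with H. And if F meshes with H in the class, then every limit of F lies in
   adh H, so lim_xi F is contained in lim_(J xi) F. Conditions (2) and (3) are exchanged by the
   Galois connection between image and preimage of filters, together with monotonicity of adherence;
   transferability is applied to the graph of f, whose relational image of a filter is its image under f. *)
theory Submission
  imports Defs
begin

text \<open>Members of \<open>inf F H\<close> are the supersets of intersections of a member of
  \<open>F\<close> with a member of \<open>H\<close>, so the infimum degenerates exactly when two
  such members are disjoint. In this lattice form, symmetry and monotonicity of meshing become
  immediate.\<close>

lemma mesh_iff_inf_neq_bot: "mesh F H \<longleftrightarrow> inf F H \<noteq> bot"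
proof
  assume m: "mesh F H"
  show "inf F H \<noteq> bot"
  proof
    assume "inf F H = bot"
    then have "eventually (\<lambda>x. False) (inf F H)" by simp
    then obtain P Q where "eventually P F" "eventually Q H" "\<And>x. P x \<Longrightarrow> Q x \<Longrightarrow> False"
      unfolding eventually_inf by blast
    then have "Collect P \<in> sets_of F" "Collect Q \<in> sets_of H" "Collect P \<inter> Collect Q = {}"
      by (auto simp: sets_of_def)
    with m show False
      unfolding mesh_def by blast
  qed
next
  assume n: "inf F H \<noteq> bot"
  show "mesh F H"
    unfolding mesh_def sets_of_def
  proof (intro ballI notI)
    fix A B
    assume "A \<in> {A. \<forall>\<^sub>F x in F. x \<in> A}" "B \<in> {A. \<forall>\<^sub>F x in H. x \<in> A}" "A \<inter> B = {}"
    then have "\<forall>\<^sub>F x in F. x \<in> A" "\<forall>\<^sub>F x in H. x \<in> B" "\<forall>x. x \<in> A \<and> x \<in> B \<longrightarrow> False"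
      by auto
    then have "inf F H = bot"
      unfolding trivial_limit_def eventually_inf by meson
    with n show False ..
  qed
qed

lemma mesh_commute: "mesh F H \<longleftrightarrow> mesh H F"
  by (simp add: mesh_iff_inf_neq_bot inf_commute)

lemma mesh_mono: "mesh F H" if "mesh F G" "G \<le> H"
  using that inf_mono[OF order_refl that(2), of F] by (metis mesh_iff_inf_neq_bot bot_unique)

text \<open>A smaller library filter is finer, hence meshes with fewer filters and collects fewer
  limits.\<close>

lemma adh_mono: "G \<le> H \<Longrightarrow> adh \<xi> G \<subseteq> adh \<xi> H"
  unfolding adh_def using mesh_mono by blast

lemma neq_bot_if_mesh: "mesh F H \<Longrightarrow> H \<noteq> bot"
  by (auto simp: mesh_iff_inf_neq_bot)

lemma filters_on_le_principal: "F \<in> filters_on X \<Longrightarrow> F \<le> principal X"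
  by (simp add: filters_on_def le_principal)

lemma filtermap_in_filters_on:
  "F \<in> filters_on X \<Longrightarrow> f ` X \<subseteq> Y \<Longrightarrow> filtermap f F \<in> filters_on Y"
  unfolding filters_on_def
  by (auto simp: eventually_filtermap filtermap_bot_iff image_subset_iff elim: eventually_mono)

lemma mesh_preimage_filter_iff:
  assumes "F \<in> filters_on X"
  shows "mesh F (preimage_filter X f H) \<longleftrightarrow> mesh (filtermap f F) H"
proof -
  have "inf F (preimage_filter X f H) = inf F (filtercomap f H)"
    using filters_on_le_principal[OF assms]
    by (simp add: preimage_filter_def inf_assoc[symmetric] inf_absorb1)
  moreover have "inf F (filtercomap f H) = bot \<longleftrightarrow> inf (filtermap f F) H = bot"
  proof
    assume "inf F (filtercomap f H) = bot"
    then obtain P Q where "eventually P F" "eventually Q H" "\<And>x. P x \<Longrightarrow> \<not> Q (f x)"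
      unfolding trivial_limit_def eventually_inf eventually_filtercomap by blast
    \<comment> \<open>The complement of \<open>Q\<close> serves as the member of the image filter:
      its preimage contains \<open>P\<close>.\<close>
    then have "eventually (\<lambda>y. \<not> Q y) (filtermap f F)" "eventually Q H"
      by (auto simp: eventually_filtermap elim: eventually_mono)
    then show "inf (filtermap f F) H = bot"
      unfolding trivial_limit_def eventually_inf by blast
  next
    assume "inf (filtermap f F) H = bot"
    then obtain P Q where "eventually P (filtermap f F)" "eventually Q H" "\<And>y. P y \<Longrightarrow> \<not> Q y"
      unfolding trivial_limit_def eventually_inf by blast
    then have "eventually (\<lambda>x. P (f x)) F" "eventually (\<lambda>x. Q (f x)) (filtercomap f H)"
        "\<forall>x. P (f x) \<and> Q (f x) \<longrightarrow> False"
      by (auto simp: eventually_filtermap intro: eventually_filtercomapI)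
    then show "inf F (filtercomap f H) = bot"
      unfolding trivial_limit_def eventually_inf by meson
  qed
  ultimately show ?thesis
    by (simp add: mesh_iff_inf_neq_bot)
qed

text \<open>One half of the Galois connection: the image of the preimage of \<open>B\<close> lies in
  \<open>B\<close>.\<close>

lemma filtermap_preimage_filter_le: "filtermap f (preimage_filter X f H) \<le> H"
  unfolding preimage_filter_def
  by (meson filtermap_filtercomap filtermap_mono inf_le2 order_trans)

text \<open>The other half: a subset of \<open>X\<close> lies in the preimage of its image.\<close>

lemma le_preimage_filter_filtermap:
  "G \<in> filters_on X \<Longrightarrow> G \<le> preimage_filter X f (filtermap f G)"
  unfolding preimage_filter_def
  by (simp add: filters_on_le_principal filtercomap_filtermap)

text \<open>Cutting the graph down to \<open>X\<close> makes it a relation between the underlying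
  sets. It replaces \<open>A\<close> by \<open>X \<inter> A\<close>, which is harmless since
  \<open>X\<close> belongs to \<open>G\<close>.\<close>

lemma relation_filter_graph:
  assumes "G \<in> filters_on X"
  shows "relation_filter {(x, f x) |x. x \<in> X} G = filtermap f G"
proof -
  have im: "{(x, f x) |x. x \<in> X} `` A = f ` (X \<inter> A)" for A
    by auto
  have X: "\<forall>\<^sub>F x in G. x \<in> X"
    using assms by (simp add: filters_on_def)
  show ?thesis
  proof (rule antisym)
    show "filtermap f G \<le> relation_filter {(x, f x) |x. x \<in> X} G"
      unfolding relation_filter_def im
    proof (rule INF_greatest)
      fix A assume "A \<in> sets_of G"
      then have "\<forall>\<^sub>F x in G. x \<in> X \<and> x \<in> A"
        using X by (simp add: sets_of_def eventually_conj)
      then show "filtermap f G \<le> principal (f ` (X \<inter> A))"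
        by (auto simp: le_principal eventually_filtermap elim: eventually_mono)
    qed
    show "relation_filter {(x, f x) |x. x \<in> X} G \<le> filtermap f G"
    proof (rule filter_leI)
      fix P assume "eventually P (filtermap f G)"
      \<comment> \<open>This preimage indexes a generator of the relational image that lies inside
        \<open>P\<close>.\<close>
      then have "{x. P (f x)} \<in> sets_of G"
        by (simp add: sets_of_def eventually_filtermap)
      then have "relation_filter {(x, f x) |x. x \<in> X} G \<le> principal (f ` (X \<inter> {x. P (f x)}))"
        unfolding relation_filter_def im by (rule INF_lower)
      then show "eventually P (relation_filter {(x, f x) |x. x \<in> X} G)"
        unfolding le_principal by (auto elim: eventually_mono)
    qed
  qed
qed

lemma transferable_filtermap:
  assumes "transferable \<J>" "filter_class \<J>" "G \<in> \<J> X" "f ` X \<subseteq> Y"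
  shows "filtermap f G \<in> \<J> Y"
proof -
  have G: "G \<in> filters_on X"
    using assms(2,3) by (auto simp: filter_class_def)
  have "{(x, f x) |x. x \<in> X} \<subseteq> X \<times> Y"
    using assms(4) by auto
  moreover have "relation_filter {(x, f x) |x. x \<in> X} G \<noteq> bot"
    using G unfolding relation_filter_graph[OF G] by (simp add: filtermap_bot_iff filters_on_def)
  ultimately have "relation_filter {(x, f x) |x. x \<in> X} G \<in> \<J> Y"
    using assms(1,3) unfolding transferable_def by blast
  then show ?thesis
    unfolding relation_filter_graph[OF G] .
qed

theorem theorem8:
  fixes \<J> :: "'u set \<Rightarrow> 'u filter set"
    and J :: "'u conv \<Rightarrow> 'u conv"
    and \<xi> \<tau> :: "'u conv"
    and f :: "'u \<Rightarrow> 'u"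
  assumes "filter_class \<J>" and "transferable \<J>"
    and "adherence_determined \<J> J"
    and "convergence \<xi>" and "convergence \<tau>"
    and "f ` points \<xi> = points \<tau>"
  shows "(continuous_conv (J \<xi>) (J \<tau>) f \<longleftrightarrow>
           (\<forall>H\<in>\<J> (points \<tau>).
              adh \<xi> (preimage_filter (points \<xi>) f H) \<subseteq> {x \<in> points \<xi>. f x \<in> adh \<tau> H})) \<and>
         ((\<forall>H\<in>\<J> (points \<tau>).
              adh \<xi> (preimage_filter (points \<xi>) f H) \<subseteq> {x \<in> points \<xi>. f x \<in> adh \<tau> H}) \<longleftrightarrow>
           (\<forall>G\<in>\<J> (points \<xi>). f ` adh \<xi> G \<subseteq> adh \<tau> (filtermap f G)))"
proof -
  let ?X = "points \<xi>" and ?Y = "points \<tau>"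
  let ?pre = "preimage_filter ?X f"
  let ?C1 = "continuous_conv (J \<xi>) (J \<tau>) f"
  let ?C2 = "\<forall>H\<in>\<J> ?Y. adh \<xi> (?pre H) \<subseteq> {x \<in> ?X. f x \<in> adh \<tau> H}"
  let ?C3 = "\<forall>G\<in>\<J> ?X. f ` adh \<xi> G \<subseteq> adh \<tau> (filtermap f G)"
  have img: "f ` ?X \<subseteq> ?Y"
    using assms(6) by simp
  have cls: "G \<in> filters_on Z" if "G \<in> \<J> Z" for G Z
    using assms(1) that by (auto simp: filter_class_def)
  have pts: "points (J \<xi>) = ?X" "points (J \<tau>) = ?Y"
    using assms(3-5) by (auto simp: adherence_determined_def)
  have lim: "limit (J \<theta>) F = \<Inter>{adh \<theta> H |H. H \<in> \<J> (points \<theta>) \<and> mesh H F}"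
    if "convergence \<theta>" "F \<in> filters_on (points \<theta>)" for \<theta> F
    using assms(3) that by (auto simp: adherence_determined_def)
  have pre: "?pre H \<in> \<J> ?X" if "H \<in> \<J> ?Y" "?pre H \<noteq> bot" for H
  proof -
    have "initial \<J>"
      using assms(3) by (simp add: adherence_determined_def)
    from this[unfolded initial_def, rule_format, OF img that] show ?thesis .
  qed
  have adhX: "adh \<xi> G \<subseteq> ?X" for G
    using assms(4) by (auto simp: adh_def convergence_def)
  have "?C2" if c: "?C1"
  proof (intro ballI subsetI)
    fix H x assume H: "H \<in> \<J> ?Y" and x: "x \<in> adh \<xi> (?pre H)"
    then obtain F where F: "F \<in> filters_on ?X" "mesh F (?pre H)" "x \<in> limit \<xi> F"
      unfolding adh_def by blast
    \<comment> \<open>\<open>F\<close> itself witnesses that \<open>x\<close> is adherent to every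
      member of the class meshing with \<open>F\<close>.\<close>
    have "x \<in> limit (J \<xi>) F"
      using F by (auto simp: lim[OF assms(4) F(1)] adh_def mesh_commute)
    then have "f x \<in> limit (J \<tau>) (filtermap f F)"
      using c F(1) by (simp add: continuous_conv_def pts image_subset_iff)
    moreover have "mesh H (filtermap f F)"
      using F(2) mesh_preimage_filter_iff[OF F(1)] by (simp add: mesh_commute)
    \<comment> \<open>\<open>H\<close> is one of the filters over which the intersection defining
      the limit in \<open>J \<tau>\<close> is taken.\<close>
    ultimately have "f x \<in> adh \<tau> H"
      using H unfolding lim[OF assms(5) filtermap_in_filters_on[OF F(1) img]] by blast
    then show "x \<in> {x \<in> ?X. f x \<in> adh \<tau> H}"
      using x adhX by blast
  qed
  moreover have "?C1" if c: "?C2"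
    unfolding continuous_conv_def pts
  proof (intro conjI ballI img image_subsetI)
    fix F x assume F: "F \<in> filters_on ?X" and x: "x \<in> limit (J \<xi>) F"
    have "f x \<in> adh \<tau> H" if H: "H \<in> \<J> ?Y" "mesh H (filtermap f F)" for H
    proof -
      have m: "mesh F (?pre H)"
        using H(2) mesh_preimage_filter_iff[OF F] by (simp add: mesh_commute)
      \<comment> \<open>Meshing makes \<open>?pre H\<close> non-degenerate, so initiality puts it in
        the class and it takes part in the intersection defining the limit in
        \<open>J \<xi>\<close>.\<close>
      have "x \<in> adh \<xi> (?pre H)"
        using x pre[OF H(1) neq_bot_if_mesh[OF m]] m[unfolded mesh_commute[of F]]
        unfolding lim[OF assms(4) F] by blast
      then show ?thesis
        using c H(1) by blast
    qed
    then show "f x \<in> limit (J \<tau>) (filtermap f F)"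
      unfolding lim[OF assms(5) filtermap_in_filters_on[OF F img]] by blast
  qed
  moreover have "?C3" if c: "?C2"
  proof (intro ballI image_subsetI)
    fix G x assume G: "G \<in> \<J> ?X" and x: "x \<in> adh \<xi> G"
    have "x \<in> adh \<xi> (?pre (filtermap f G))"
      using adh_mono[OF le_preimage_filter_filtermap[OF cls[OF G]]] x by blast
    then show "f x \<in> adh \<tau> (filtermap f G)"
      using c transferable_filtermap[OF assms(2,1) G img] by blast
  qed
  moreover have "?C2" if c: "?C3"
  proof (intro ballI subsetI)
    fix H x assume H: "H \<in> \<J> ?Y" and x: "x \<in> adh \<xi> (?pre H)"
    \<comment> \<open>A degenerate filter meshes with nothing and has empty adherence; the point
      \<open>x\<close> rules this out, so (3) can be applied to \<open>?pre H\<close>.\<close>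
    then have "?pre H \<noteq> bot"
      using neq_bot_if_mesh unfolding adh_def by blast
    then have "f x \<in> adh \<tau> (filtermap f (?pre H))"
      using c pre[OF H] x by blast
    then have "f x \<in> adh \<tau> H"
      by (rule subsetD[OF adh_mono[OF filtermap_preimage_filter_le]])
    then show "x \<in> {x \<in> ?X. f x \<in> adh \<tau> H}"
      using x adhX by blast
  qed
  ultimately show ?thesis
    by blast
qed

end
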